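(* Let $f$ be a $C^1$ diffeomorphism of $M=\mathbb{R}^d/\mathbb{Z}^d$ and let $\Lambda\subseteq M$ be a closed $f$-invariant set. Then $\Lambda$ is uniformly hyperbolic if and only if there exists $n_0\in\{1,2,3,\dots\}\cup\{\infty\}$ such that for every $x\in\Lambda$ the operator $\Gamma_{o(x)}$ has a continuous inverse on $X_{n_0}$ and $\sup_{x\in\Lambda}\|\Gamma_{o(x)}^{-1}\|_{n_0}<\infty$. Moreover, if this holds for some $n_0$, then it holds for every sufficiently large positive integer $n$ (and for $n=\infty$) in place of $n_0$.
   Context: $M=\mathbb{R}^d/\mathbb{Z}^d$ with its flat metric; each tangent space $T_xM$ is identified with $\mathbb{R}^d$, $|\cdot|$ is the Euclidean norm on $\mathbb{R}^d$ and the induced operator norm on linear maps. For $x\in M$, $o(x)=(f^k(x))_{k\in\mathbb{Z}}\in M^{\mathbb{Z}}$. For $\mathbf{x}=(x_k)_{k\in\mathbb{Z}}\in M^{\mathbb{Z}}$ define the linear operator $\Gamma_{\mathbf{x}}$ on sequences $\eta=(\eta_k)_{k\in\mathbb{Z}}$, $\eta_k\in\mathbb{R}^d$, by $(\Gamma_{\mathbf{x}}\eta)_k=\eta_k-Df(x_{k-1})\eta_{k-1}$. For a positive integer $n$ let $\|\eta\|_n=\sup_{k\in\mathbb{Z}}e^{-|k|/n}|\eta_k|$ and $X_n=\{\eta:\|\eta\|_n<\infty\}$; $X_\infty$ is the Banach space of bounded sequences with $\|\eta\|_\infty=\sup_k|\eta_k|$. Operator norms on $X_n$ are denoted $\|\cdot\|_n$.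 A compact invariant set $\Lambda$ is uniformly hyperbolic if there are constants $c>0$, $0<\lambda<1$ and for each $x\in\Lambda$ a splitting $T_xM=E^s(x)\oplus E^u(x)$ with $Df(x)E^s(x)=E^s(f(x))$, $Df(x)E^u(x)=E^u(f(x))$, $|Df^k(x)\eta|\le c\lambda^k|\eta|$ for $\eta\in E^s(x)$, $k>0$, and $|Df^{-k}(x)\eta|\le c\lambda^k|\eta|$ for $\eta\in E^u(x)$, $k>0$. *)

theory Defs
  imports "HOL-Analysis.Analysis" "HOL-Library.Extended_Nat"
begin

definition tor_rel :: "real^'n \<Rightarrow> real^'n \<Rightarrow> bool" where
  "tor_rel x y \<longleftrightarrow> (\<forall>i. x$i - y$i \<in> \<int>)"

lemma tor_rel_equivp: "equivp tor_rel"
proof (rule equivpI)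
  show "reflp tor_rel" by (auto simp: reflp_def tor_rel_def)
  show "symp tor_rel" unfolding symp_def tor_rel_def
    by (metis Ints_minus minus_diff_eq)
  show "transp tor_rel" unfolding transp_def tor_rel_def
    by (metis Ints_add diff_add_cancel add_diff_eq diff_diff_eq2)
qed

quotient_type 'n torus = "real^'n" / tor_rel
  by (rule tor_rel_equivp)

text \<open>Projection R^d \<rightarrow> M is abs_torus; rep_torus picks a representative.
  Topology on M: the quotient topology, so a set is closed iff its preimage is closed.\<close>

definition torus_closed :: "'n::finite torus set \<Rightarrow> bool" where
  "torus_closed S \<longleftrightarrow> closed (abs_torus -` S)"

definition is_lift :: "('n::finite torus \<Rightarrow> 'n torus) \<Rightarrow> (real^'n \<Rightarrow> real^'n) \<Rightarrow> bool" where
  "is_lift f F \<longleftrightarrow> (\<forall>x. abs_torus (F x) = f (abs_torus x))"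

definition C1_torus :: "('n::finite torus \<Rightarrow> 'n torus) \<Rightarrow> bool" where
  "C1_torus f \<longleftrightarrow> (\<exists>F F'. is_lift f F \<and>
      (\<forall>y. (F has_derivative blinfun_apply (F' y)) (at y)) \<and> continuous_on UNIV F')"

definition C1_diffeo_torus :: "('n::finite torus \<Rightarrow> 'n torus) \<Rightarrow> bool" where
  "C1_diffeo_torus f \<longleftrightarrow> bij f \<and> C1_torus f \<and> C1_torus (inv f)"

text \<open>Derivative Df(x) : T_xM = R^d \<rightarrow> T_{f x}M = R^d, computed from a lift
  at a representative of x (independent of the choices).\<close>
definition Dmap :: "('n::finite torus \<Rightarrow> 'n torus) \<Rightarrow> 'n torus \<Rightarrow> (real^'n \<Rightarrow> real^'n)" where
  "Dmap f x = (SOME L. \<exists>F. is_lift f F \<and> (F has_derivative L) (at (rep_torus x)))"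

fun Dpow :: "('n::finite torus \<Rightarrow> 'n torus) \<Rightarrow> nat \<Rightarrow> 'n torus \<Rightarrow> (real^'n \<Rightarrow> real^'n)" where
  "Dpow g 0 x = id"
| "Dpow g (Suc k) x = Dmap g ((g ^^ k) x) \<circ> Dpow g k x"

definition unif_hyperbolic :: "('n::finite torus \<Rightarrow> 'n torus) \<Rightarrow> 'n::finite torus set \<Rightarrow> bool" where
  "unif_hyperbolic f \<Lambda> \<longleftrightarrow>
    (\<exists>c::real. \<exists>lam::real. \<exists>Es Eu :: 'n torus \<Rightarrow> (real^'n) set.
       c > 0 \<and> 0 < lam \<and> lam < 1 \<and>
       (\<forall>x\<in>\<Lambda>.
          subspace (Es x) \<and> subspace (Eu x) \<and> Es x \<inter> Eu x = {0} \<and>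
          (\<forall>v. \<exists>a\<in>Es x. \<exists>b\<in>Eu x. v = a + b) \<and>
          Dmap f x ` Es x = Es (f x) \<and> Dmap f x ` Eu x = Eu (f x) \<and>
          (\<forall>k>0. \<forall>\<eta>\<in>Es x. norm (Dpow f k x \<eta>) \<le> c * lam ^ k * norm \<eta>) \<and>
          (\<forall>k>0. \<forall>\<eta>\<in>Eu x. norm (Dpow (inv f) k x \<eta>) \<le> c * lam ^ k * norm \<eta>)))"

definition orbit :: "('n::finite torus \<Rightarrow> 'n torus) \<Rightarrow> 'n torus \<Rightarrow> int \<Rightarrow> 'n torus" where
  "orbit f x k = (if k \<ge> 0 then (f ^^ nat k) x else (inv f ^^ nat (- k)) x)"

definition Gamma :: "('n::finite torus \<Rightarrow> 'n torus) \<Rightarrow> (int \<Rightarrow> 'n torus)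
                      \<Rightarrow> (int \<Rightarrow> real^'n) \<Rightarrow> (int \<Rightarrow> real^'n)" where
  "Gamma f xs \<eta> = (\<lambda>k. \<eta> k - Dmap f (xs (k - 1)) (\<eta> (k - 1)))"

definition weight :: "enat \<Rightarrow> int \<Rightarrow> real" where
  "weight n k = (case n of enat m \<Rightarrow> exp (- real_of_int \<bar>k\<bar> / real m) | \<infinity> \<Rightarrow> 1)"

definition Xsp :: "enat \<Rightarrow> (int \<Rightarrow> real^'n::finite) set" where
  "Xsp n = {\<eta>. bdd_above (range (\<lambda>k. weight n k * norm (\<eta> k)))}"

definition seqnorm :: "enat \<Rightarrow> (int \<Rightarrow> real^'n::finite) \<Rightarrow> real" where
  "seqnorm n \<eta> = (SUP k. weight n k * norm (\<eta> k))"

definition has_cont_inverse :: "enat \<Rightarrow> ((int \<Rightarrow> real^'n::finite) \<Rightarrow> (int \<Rightarrow> real^'n)) \<Rightarrow> bool" where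
  "has_cont_inverse n T \<longleftrightarrow> bij_betw T (Xsp n) (Xsp n) \<and>
     (\<exists>C. \<forall>\<eta>\<in>Xsp n. seqnorm n (inv_into (Xsp n) T \<eta>) \<le> C * seqnorm n \<eta>)"

definition opnorm :: "enat \<Rightarrow> ((int \<Rightarrow> real^'n::finite) \<Rightarrow> (int \<Rightarrow> real^'n)) \<Rightarrow> real" where
  "opnorm n S = (SUP \<eta>\<in>{\<eta>\<in>Xsp n. seqnorm n \<eta> \<le> 1}. seqnorm n (S \<eta>))"

definition Gamma_cond :: "('n::finite torus \<Rightarrow> 'n torus) \<Rightarrow> 'n torus set \<Rightarrow> enat \<Rightarrow> bool" where
  "Gamma_cond f \<Lambda> n \<longleftrightarrow>
     (\<forall>x\<in>\<Lambda>. has_cont_inverse n (Gamma f (orbit f x))) \<and>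
     bdd_above ((\<lambda>x. opnorm n (inv_into (Xsp n) (Gamma f (orbit f x)))) ` \<Lambda>)"

end

theory Submission
  imports Defs
begin

text \<open>If \<open>\<Gamma>\<close> is uniformly invertible on \<open>X\<^sub>n\<close>, shifting along orbits gives the bound
  \<open>|\<eta>\<^sub>k| \<le> C sup |\<Gamma>\<eta>|\<close> with the same \<open>C\<close> at every index. Stable and unstable vectors
  are those with bounded forward, respectively backward, orbit: such a half orbit, extended by zero,
  solves \<open>\<Gamma>\<eta> = \<delta>\<^sub>0 v\<close>, and so does the solution that splits an arbitrary \<open>v\<close> into a stable and an
  unstable part. Multiplying a solution by slowly growing weights perturbs \<open>\<Gamma>\<close> only slightly and
  yields exponential decay. Conversely a hyperbolic splitting has uniformly bounded projections, and
  the Green series \<open>\<Sum> Df\<^sup>m P \<zeta> - \<Sum> Df\<^sup>-\<^sup>m (1 - P) \<zeta>\<close> inverts \<open>\<Gamma>\<close> on \<open>X\<^sub>n\<close> as soon as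
  \<open>\<lambda> e\<^bsup>1/n\<^esup> < 1\<close>.\<close>

section \<open>Bounded sequences and geometric majorants\<close>

lemma bounded_Suc_iff:
  fixes u :: "nat \<Rightarrow> 'a::real_normed_vector"
  shows "(\<exists>K. \<forall>m. norm (u (Suc m)) \<le> K) \<longleftrightarrow> (\<exists>K. \<forall>m. norm (u m) \<le> K)"
proof
  assume "\<exists>K. \<forall>m. norm (u (Suc m)) \<le> K"
  then obtain K where K: "\<And>m. norm (u (Suc m)) \<le> K" by blast
  have "norm (u m) \<le> max K (norm (u 0))" for m
    using K by (cases m) (auto simp: le_max_iff_disj)
  then show "\<exists>K. \<forall>m. norm (u m) \<le> K" by blast
qed blast

lemma geometric_bound_summable:
  fixes u :: "nat \<Rightarrow> 'a::banach"
  assumes "\<And>m. norm (u m) \<le> M * q ^ m" "0 \<le> q" "q < 1"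
  shows "summable u" "norm (suminf u) \<le> M / (1 - q)"
proof -
  have s: "(\<lambda>m. M * q ^ m) sums (M * (1 / (1 - q)))"
    using assms by (intro sums_mult geometric_sums) auto
  show "summable u"
    by (rule summable_comparison_test'[OF sums_summable[OF s]]) (use assms in auto)
  show "norm (suminf u) \<le> M / (1 - q)"
    using norm_suminf_le[of u, OF assms(1) sums_summable[OF s]] sums_unique[OF s] by simp
qed

subsection \<open>Derivatives on the torus\<close>

lemma abs_torus_eq_iff: "abs_torus x = abs_torus y \<longleftrightarrow> tor_rel x y"
  by (rule torus.abs_eq_iff)

lemma abs_rep_torus: "abs_torus (rep_torus x) = x"
  by (rule Quotient3_abs_rep[OF Quotient3_torus])

text \<open>Differentiability gives continuity at \<open>z\<close>, and a map with integer
  components that is continuous at \<open>z\<close> is constant near \<open>z\<close>.\<close>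

lemma integer_valued_has_derivative_0:
  fixes D :: "'a::euclidean_space \<Rightarrow> real^'n"
  assumes der: "(D has_derivative D') (at z)" and int: "\<And>u i. D u $ i \<in> \<int>"
  shows "D' = (\<lambda>_. 0)"
proof -
  have "isCont D z"
    using der has_derivative_continuous by blast
  then have "(D \<longlongrightarrow> D z) (at z)"
    by (simp add: isCont_def)
  then have "\<forall>\<^sub>F u in at z. dist (D u) (D z) < 1"
    by (rule tendstoD) simp
  then have ev: "\<forall>\<^sub>F u in at z. D u = D z"
  proof (rule eventually_mono)
    fix u assume d: "dist (D u) (D z) < 1"
    show "D u = D z"
    proof (rule vec_eq_iff[THEN iffD2], rule allI)
      fix i
      have "\<bar>D u $ i - D z $ i\<bar> < 1"
        using component_le_norm_cart[of "D u - D z" i] d by (simp add: dist_norm)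
      then show "D u $ i = D z $ i"
        using int[of u i] int[of z i] Ints_nonzero_abs_less1[of "D u $ i - D z $ i"] by auto
    qed
  qed
  then have "((\<lambda>_. D z) has_derivative D') (at z)"
    using has_derivative_transform_eventually[OF der] by simp
  then show ?thesis
    using has_derivative_unique[OF _ has_derivative_const] by blast
qed

text \<open>Since \<open>is_lift\<close> does not ask for continuity, two lifts need not differ by a
  constant lattice vector. But translating \<open>F\<close> by the lattice vector
  \<open>y - z\<close> gives a lift with derivative \<open>A\<close> at \<open>z\<close>, and its
  difference from \<open>G\<close> has integer components, hence zero derivative there.\<close>

lemma lift_derivative_unique:
  fixes f :: "'n::finite torus \<Rightarrow> 'n torus"
  assumes F: "is_lift f F" "(F has_derivative A) (at y)"
    and G: "is_lift f G" "(G has_derivative B) (at z)"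
    and yz: "tor_rel y z"
  shows "A = B"
proof -
  define H where "H u = F (u + (y - z))" for u
  have shift: "abs_torus (u + (y - z)) = abs_torus u" for u
    unfolding abs_torus_eq_iff using yz by (simp add: tor_rel_def)
  have HG: "abs_torus (H u) = abs_torus (G u)" for u
    using F(1) G(1) shift by (simp add: is_lift_def H_def)
  have "(H has_derivative A) (at z)"
  proof -
    have "((\<lambda>u. u + (y - z)) has_derivative (\<lambda>h. h)) (at z)"
      by (auto intro!: derivative_eq_intros)
    from diff_chain_at[OF this, of F A] F(2) show ?thesis
      by (simp add: H_def[abs_def] o_def)
  qed
  then have "((\<lambda>u. H u - G u) has_derivative (\<lambda>h. A h - B h)) (at z)"
    using G(2) by (rule has_derivative_diff)
  moreover have "(H u - G u) $ i \<in> \<int>" for u i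
    using HG[of u] by (simp add: abs_torus_eq_iff tor_rel_def)
  ultimately have "(\<lambda>h. A h - B h) = (\<lambda>_. 0)"
    by (rule integer_valued_has_derivative_0)
  then show ?thesis
    by (auto simp: fun_eq_iff)
qed

text \<open>A differentiable lift makes the choice in \<open>Dmap\<close> a choice from a nonempty
  set, and uniqueness of the derivative identifies the result. The representative \<open>y\<close>
  is arbitrary, so a convenient one can be taken later.\<close>

lemma Dmap_eq:
  fixes f :: "'n::finite torus \<Rightarrow> 'n torus"
  assumes "is_lift f F" "\<And>y. (F has_derivative blinfun_apply (F' y)) (at y)"
    and y: "abs_torus y = x"
  shows "Dmap f x = blinfun_apply (F' y)"
proof -
  have yx: "tor_rel y (rep_torus x)"
    using y abs_rep_torus[of x] by (simp flip: abs_torus_eq_iff)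
  have "\<exists>G. is_lift f G \<and> (G has_derivative Dmap f x) (at (rep_torus x))"
    unfolding Dmap_def
    by (rule someI_ex[of "\<lambda>L. \<exists>G. is_lift f G \<and> (G has_derivative L) (at (rep_torus x))"])
      (use assms(1,2) in blast)
  then obtain G where "is_lift f G" "(G has_derivative Dmap f x) (at (rep_torus x))"
    by blast
  from lift_derivative_unique[OF assms(1,2) this yx] show ?thesis ..
qed

lemma bounded_linear_Dmap:
  assumes "C1_torus f"
  shows "bounded_linear (Dmap f x)"
proof -
  obtain F F' where F: "is_lift f F" "\<And>y. (F has_derivative blinfun_apply (F' y)) (at y)"
    using assms by (auto simp: C1_torus_def)
  show ?thesis
    by (simp add: Dmap_eq[OF F abs_rep_torus] blinfun.bounded_linear_right)
qed

text \<open>The compact unit cube contains a representative of every point, so a bound for the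
  continuous \<open>F'\<close> on the cube serves everywhere.\<close>

lemma Dmap_norm_bound:
  fixes f :: "'n::finite torus \<Rightarrow> 'n torus"
  assumes "C1_torus f"
  obtains L where "L > 0" "\<And>x v. norm (Dmap f x v) \<le> L * norm v"
proof -
  obtain F F' where F: "is_lift f F" "\<And>y. (F has_derivative blinfun_apply (F' y)) (at y)"
      "continuous_on UNIV F'"
    using assms by (auto simp: C1_torus_def)
  have "compact (F' ` cbox 0 1)"
    using F(3) by (intro compact_continuous_image compact_cbox) (auto intro: continuous_on_subset)
  then have "bounded (F' ` cbox 0 1)"
    by (rule compact_imp_bounded)
  then obtain L where L: "L > 0" "\<And>y. y \<in> cbox 0 1 \<Longrightarrow> norm (F' y) \<le> L"
    by (auto simp: bounded_pos)
  have "norm (Dmap f x v) \<le> L * norm v" for x v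
  proof -
    define y :: "real^'n" where "y = (\<chi> i. frac (rep_torus x $ i))"
    have "tor_rel y (rep_torus x)"
      by (simp add: tor_rel_def y_def frac_def)
    then have "abs_torus y = x"
      using abs_rep_torus[of x] by (simp flip: abs_torus_eq_iff)
    then have "Dmap f x = blinfun_apply (F' y)"
      by (rule Dmap_eq[OF F(1,2)])
    moreover have "y \<in> cbox 0 1"
      by (auto simp: mem_box_cart y_def less_imp_le frac_lt_1)
    ultimately show ?thesis
      using norm_blinfun[of "F' y" v] mult_right_mono[OF L(2)[of y] norm_ge_zero[of v]] by simp
  qed
  then show ?thesis
    using L(1) that by blast
qed

text \<open>By the chain rule: \<open>G \<circ> F\<close> and \<open>id\<close> both lift the
  identity, so their derivatives agree.\<close>

lemma Dmap_inverse:
  fixes f g :: "'n::finite torus \<Rightarrow> 'n torus"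
  assumes "C1_torus f" "C1_torus g" and gf: "\<And>x. g (f x) = x"
  shows "Dmap g (f x) (Dmap f x v) = v"
proof -
  obtain F F' where F: "is_lift f F" "\<And>y. (F has_derivative blinfun_apply (F' y)) (at y)"
    using assms(1) by (auto simp: C1_torus_def)
  obtain G G' where G: "is_lift g G" "\<And>y. (G has_derivative blinfun_apply (G' y)) (at y)"
    using assms(2) by (auto simp: C1_torus_def)
  define y where "y = rep_torus x"
  have y: "abs_torus y = x" "abs_torus (F y) = f x"
    using F(1) by (auto simp: y_def abs_rep_torus is_lift_def)
  have "((G \<circ> F) has_derivative (G' (F y)) \<circ> (F' y)) (at y)"
    by (rule diff_chain_at[OF F(2) G(2)])
  moreover have "is_lift id (G \<circ> F)"
    using F(1) G(1) gf by (auto simp: is_lift_def)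
  ultimately have "blinfun_apply (G' (F y)) \<circ> blinfun_apply (F' y) = id"
    using lift_derivative_unique[of id "G \<circ> F" _ y id id y]
    by (simp add: is_lift_def tor_rel_def has_derivative_id)
  moreover have "Dmap f x = F' y" "Dmap g (f x) = G' (F y)"
    by (rule Dmap_eq[OF F y(1)], rule Dmap_eq[OF G y(2)])
  ultimately show ?thesis
    by (metis comp_apply id_apply)
qed

subsection \<open>Weighted sequence spaces\<close>

text \<open>For \<open>n = 0\<close> division by zero gives the same values here and in \<open>weight\<close> as \<open>n = \<infinity>\<close>.\<close>
definition weight_rate :: "enat \<Rightarrow> real" where
  "weight_rate n = (case n of enat m \<Rightarrow> exp (1 / real m) | \<infinity> \<Rightarrow> 1)"

lemma weight_rate_ge_1: "1 \<le> weight_rate n"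
  by (auto simp: weight_rate_def split: enat.splits)

lemma weight_pos: "0 < weight n k"
  by (auto simp: weight_def split: enat.splits)

lemma weight_0 [simp]: "weight n 0 = 1"
  by (auto simp: weight_def split: enat.splits)

lemma weight_le_1: "weight n k \<le> 1"
  by (auto simp: weight_def split: enat.splits)

text \<open>Triangle inequality in the exponent: \<open>weight_rate n\<close> is the cost of moving
  the index by one.\<close>

lemma weight_le_shift:
  assumes "\<bar>k - j\<bar> \<le> int m"
  shows "weight n k \<le> weight_rate n ^ m * weight n j"
proof (cases n)
  case (enat p)
  have "real_of_int \<bar>j\<bar> \<le> real m + real_of_int \<bar>k\<bar>"
    using assms by linarith
  then have "- real_of_int \<bar>k\<bar> / real p \<le> real m / real p - real_of_int \<bar>j\<bar> / real p"
    by (simp add: divide_right_mono minus_divide_left del: minus_divide_left[symmetric] flip: diff_divide_distrib)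
  then show ?thesis
    by (simp add: enat weight_def weight_rate_def flip: exp_of_nat_mult exp_add)
qed (simp add: weight_def weight_rate_def)

lemma weight_norm_le_seqnorm: "\<eta> \<in> Xsp n \<Longrightarrow> weight n k * norm (\<eta> k) \<le> seqnorm n \<eta>"
  unfolding seqnorm_def Xsp_def by (auto intro: cSUP_upper)

lemma seqnorm_nonneg: "\<eta> \<in> Xsp n \<Longrightarrow> 0 \<le> seqnorm n \<eta>"
  using weight_norm_le_seqnorm[of \<eta> n 0] by (simp add: order_trans[OF norm_ge_zero])

lemma XspI: "(\<And>k. weight n k * norm (\<eta> k) \<le> C) \<Longrightarrow> \<eta> \<in> Xsp n"
  unfolding Xsp_def mem_Collect_eq by (rule bdd_aboveI2)

lemma seqnorm_leI: "(\<And>k. weight n k * norm (\<eta> k) \<le> C) \<Longrightarrow> seqnorm n \<eta> \<le> C"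
  unfolding seqnorm_def by (auto intro: cSUP_least)

text \<open>Comparing an entry with the weight at a different index \<open>k\<close> is what later
  turns series over the whole orbit into geometric series.\<close>

lemma Xsp_norm_le:
  assumes "\<eta> \<in> Xsp n" "\<bar>k - j\<bar> \<le> int m"
  shows "norm (\<eta> j) \<le> seqnorm n \<eta> / weight n k * weight_rate n ^ m"
proof -
  have "weight n k * norm (\<eta> j) \<le> weight_rate n ^ m * (weight n j * norm (\<eta> j))"
    using weight_le_shift[OF assms(2), of n] by (simp add: mult_right_mono flip: mult.assoc)
  also have "\<dots> \<le> weight_rate n ^ m * seqnorm n \<eta>"
    using weight_norm_le_seqnorm[OF assms(1)] weight_rate_ge_1[of n] by (intro mult_left_mono) auto
  finally show ?thesis
    using weight_pos[of n k] by (simp add: field_simps)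
qed

lemma bounded_in_Xsp:
  assumes "\<And>k. norm (\<eta> k) \<le> C"
  shows "\<eta> \<in> Xsp n"
proof (rule XspI)
  fix k
  show "weight n k * norm (\<eta> k) \<le> C"
    using mult_mono[OF weight_le_1 assms] weight_pos[of n k] order_trans[OF norm_ge_zero assms] by simp
qed

lemma Xsp_shift:
  assumes "\<eta> \<in> Xsp n"
  shows "(\<lambda>k. \<eta> (k + j)) \<in> Xsp n"
proof (rule XspI)
  fix k
  show "weight n k * norm (\<eta> (k + j)) \<le> seqnorm n \<eta> * weight_rate n ^ nat \<bar>j\<bar>"
    using Xsp_norm_le[OF assms, of k "k + j" "nat \<bar>j\<bar>"] weight_pos[of n k] by (simp add: field_simps)
qed

lemma Xsp_scaleR:
  assumes "\<eta> \<in> Xsp n"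
  shows "(\<lambda>k. c *\<^sub>R \<eta> k) \<in> Xsp n"
proof (rule XspI)
  fix k
  show "weight n k * norm (c *\<^sub>R \<eta> k) \<le> \<bar>c\<bar> * seqnorm n \<eta>"
    using mult_left_mono[OF weight_norm_le_seqnorm[OF assms, of k], of "\<bar>c\<bar>"] by (simp add: algebra_simps)
qed

lemma Xsp_diff:
  assumes "\<eta> \<in> Xsp n" "\<zeta> \<in> Xsp n"
  shows "(\<lambda>k. \<eta> k - \<zeta> k) \<in> Xsp n"
proof (rule XspI)
  fix k
  have "weight n k * norm (\<eta> k - \<zeta> k) \<le> weight n k * norm (\<eta> k) + weight n k * norm (\<zeta> k)"
    using norm_triangle_ineq4[of "\<eta> k" "\<zeta> k"] weight_pos[of n k] by (simp flip: distrib_left)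
  then show "weight n k * norm (\<eta> k - \<zeta> k) \<le> seqnorm n \<eta> + seqnorm n \<zeta>"
    using assms[THEN weight_norm_le_seqnorm, of k] by linarith
qed

text \<open>\<open>opnorm\<close> is a supremum of reals and bounds its members only if the set is
  bounded above; the constant in \<open>has_cont_inverse\<close> supplies this.\<close>

lemma has_cont_inverse_seqnorm_le_opnorm:
  assumes inv: "has_cont_inverse n T" and \<eta>: "\<eta> \<in> Xsp n" and T\<eta>: "seqnorm n (T \<eta>) \<le> 1"
  shows "seqnorm n \<eta> \<le> opnorm n (inv_into (Xsp n) T)"
proof -
  obtain C where bij: "bij_betw T (Xsp n) (Xsp n)"
    and C: "\<And>\<eta>. \<eta> \<in> Xsp n \<Longrightarrow> seqnorm n (inv_into (Xsp n) T \<eta>) \<le> C * seqnorm n \<eta>"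
    using inv by (auto simp: has_cont_inverse_def)
  have bdd: "bdd_above ((\<lambda>\<zeta>. seqnorm n (inv_into (Xsp n) T \<zeta>)) ` {\<zeta> \<in> Xsp n. seqnorm n \<zeta> \<le> 1})"
  proof (rule bdd_aboveI2)
    fix \<zeta> :: "int \<Rightarrow> real^'a" assume "\<zeta> \<in> {\<zeta> \<in> Xsp n. seqnorm n \<zeta> \<le> 1}"
    then have \<zeta>: "\<zeta> \<in> Xsp n" "seqnorm n \<zeta> \<le> 1" by auto
    \<comment> \<open>\<open>C\<close> has no prescribed sign, hence the absolute value.\<close>
    have "C * seqnorm n \<zeta> \<le> \<bar>C\<bar> * 1"
      using \<zeta>(2) seqnorm_nonneg[OF \<zeta>(1)] by (intro mult_mono) auto
    then show "seqnorm n (inv_into (Xsp n) T \<zeta>) \<le> \<bar>C\<bar>"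
      using C[OF \<zeta>(1)] by simp
  qed
  have "T \<eta> \<in> {\<zeta> \<in> Xsp n. seqnorm n \<zeta> \<le> 1}"
    using bij \<eta> T\<eta> by (auto dest: bij_betwE)
  from cSUP_upper[OF this bdd] show ?thesis
    using bij \<eta> by (simp add: opnorm_def bij_betw_inv_into_left)
qed

text \<open>A lower bound for \<open>T\<close> is an upper bound for its inverse.\<close>

lemma has_cont_inverseI:
  assumes bij: "bij_betw T (Xsp n) (Xsp n)"
    and C: "0 \<le> C" "\<And>\<eta>. \<eta> \<in> Xsp n \<Longrightarrow> seqnorm n \<eta> \<le> C * seqnorm n (T \<eta>)"
  shows "has_cont_inverse n T" "opnorm n (inv_into (Xsp n) T) \<le> C"
proof -
  have inv: "seqnorm n (inv_into (Xsp n) T \<zeta>) \<le> C * seqnorm n \<zeta>" if "\<zeta> \<in> Xsp n" for \<zeta>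
    using C(2)[of "inv_into (Xsp n) T \<zeta>"] bij that
    by (metis bij_betw_def bij_betw_inv_into_right inv_into_into)
  then show "has_cont_inverse n T"
    using bij by (auto simp: has_cont_inverse_def)
  \<comment> \<open>The supremum defining \<open>opnorm\<close> runs over a nonempty set.\<close>
  have "(\<lambda>_. 0) \<in> {\<eta> \<in> Xsp n. seqnorm n \<eta> \<le> 1}"
    by (auto intro!: XspI[of _ _ 0] seqnorm_leI)
  then show "opnorm n (inv_into (Xsp n) T) \<le> C"
    unfolding opnorm_def
  proof (intro cSUP_least)
    fix \<zeta> :: "int \<Rightarrow> real^'a" assume "\<zeta> \<in> {\<zeta> \<in> Xsp n. seqnorm n \<zeta> \<le> 1}"
    then show "seqnorm n (inv_into (Xsp n) T \<zeta>) \<le> C"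
      using inv[of \<zeta>] mult_left_mono[of "seqnorm n \<zeta>" 1 C] C(1) by simp
  qed auto
qed

subsection \<open>Dynamics of the derivative cocycle\<close>

lemma Dpow_linear:
  fixes g :: "'n::finite torus \<Rightarrow> 'n torus"
  assumes "C1_torus g"
  shows "bounded_linear (Dpow g m x)"
proof (induction m)
  case (Suc m)
  then show ?case
    using bounded_linear_compose[OF bounded_linear_Dmap[OF assms] Suc] by (simp add: o_def)
qed (simp add: id_def)

text \<open>The recursion of \<open>Dpow\<close> splits off the last factor; this form splits off
  the first.\<close>

lemma Dpow_Suc_shift: "Dpow g (Suc m) x v = Dpow g m (g x) (Dmap g x v)"
  by (induction m) (simp_all add: funpow_swap1)

lemma subspace_bounded_Dpow:
  fixes g :: "'n::finite torus \<Rightarrow> 'n torus"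
  assumes "C1_torus g"
  shows "subspace {v. \<exists>K. \<forall>m. norm (Dpow g m x v) \<le> K}"
proof -
  note lin = bounded_linear.linear[OF Dpow_linear[OF assms]]
  show ?thesis
    unfolding subspace_def
  proof (intro conjI ballI allI; clarsimp)
    show "\<exists>K. \<forall>m. norm (Dpow g m x 0) \<le> K"
      using lin by (auto simp: linear_0)
  next
    fix v w K1 K2
    assume "\<forall>m. norm (Dpow g m x v) \<le> K1" "\<forall>m. norm (Dpow g m x w) \<le> K2"
    then have "norm (Dpow g m x (v + w)) \<le> K1 + K2" for m
      using lin by (simp add: linear_add norm_triangle_mono)
    then show "\<exists>K. \<forall>m. norm (Dpow g m x (v + w)) \<le> K" by blast
  next
    fix c v K
    assume "\<forall>m. norm (Dpow g m x v) \<le> K"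
    then have "norm (Dpow g m x (c *\<^sub>R v)) \<le> \<bar>c\<bar> * K" for m
      using lin by (simp add: linear_scale mult_left_mono)
    then show "\<exists>K. \<forall>m. norm (Dpow g m x (c *\<^sub>R v)) \<le> K" by blast
  qed
qed

locale torus_diffeo =
  fixes f :: "'n::finite torus \<Rightarrow> 'n torus"
  assumes diffeo: "C1_diffeo_torus f"
begin

lemma C1: "C1_torus f" and C1_inv: "C1_torus (inv f)" and bij: "bij f"
  using diffeo by (auto simp: C1_diffeo_torus_def)

lemma inv_f [simp]: "inv f (f x) = x"
  by (meson bij bij_is_inj inv_f_f)

lemma f_inv [simp]: "f (inv f x) = x"
  by (meson bij bij_is_surj surj_f_inv_f)

lemma Dmap_inv_Dmap [simp]: "Dmap (inv f) (f x) (Dmap f x v) = v"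
  by (rule Dmap_inverse[OF C1 C1_inv inv_f])

lemma Dmap_Dmap_inv [simp]: "Dmap f x (Dmap (inv f) (f x) v) = v"
  using Dmap_inverse[OF C1_inv C1 f_inv, of "f x" v] by simp

lemma Dmap_linear: "bounded_linear (Dmap f x)"
  by (rule bounded_linear_Dmap[OF C1])

lemma Dpow_inv_Dpow: "Dpow (inv f) m ((f ^^ m) x) (Dpow f m x v) = v"
proof (induction m)
  case (Suc m)
  have "Dpow (inv f) (Suc m) ((f ^^ Suc m) x) (Dpow f (Suc m) x v)
      = Dpow (inv f) m ((f ^^ m) x) (Dpow f m x v)"
    unfolding Dpow_Suc_shift[of "inv f"] by simp
  with Suc show ?case by simp
qed simp

lemma Dpow_norm_bound:
  assumes "\<And>x v. norm (Dmap f x v) \<le> L * norm v" "0 \<le> L"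
  shows "norm (Dpow f m x v) \<le> L ^ m * norm v"
proof (induction m)
  case (Suc m)
  have "norm (Dpow f (Suc m) x v) \<le> L * norm (Dpow f m x v)"
    using assms(1) by simp
  also have "\<dots> \<le> L * (L ^ m * norm v)"
    using Suc assms(2) by (rule mult_left_mono)
  finally show ?case by (simp add: mult.assoc)
qed simp

section \<open>Orbits and the operator \<open>Gamma\<close> along them\<close>

lemma orbit_0 [simp]: "orbit f x 0 = x"
  by (simp add: orbit_def)

lemma orbit_Suc: "orbit f x (k + 1) = f (orbit f x k)"
proof (cases "k \<ge> 0")
  case True
  then show ?thesis by (simp add: orbit_def nat_add_distrib)
next
  case False
  then have k: "nat (- k) = Suc (nat (- (k + 1)))" by simp
  show ?thesis
  \<comment> \<open>The two branches of \<open>orbit\<close> meet at \<open>k = -1\<close>.\<close>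
  proof (cases "k = -1")
    case False
    then show ?thesis
      using \<open>\<not> k \<ge> 0\<close> unfolding orbit_def k by simp
  qed (simp add: orbit_def)
qed

lemma f_orbit_pred [simp]: "f (orbit f x (k - 1)) = orbit f x k"
  using orbit_Suc[of x "k - 1"] by simp

lemma inv_orbit [simp]: "inv f (orbit f x k) = orbit f x (k - 1)"
  using f_orbit_pred[of x k] inv_f by metis

lemma orbit_add_nat: "orbit f x (k + int m) = (f ^^ m) (orbit f x k)"
proof (induction m)
  case (Suc m)
  have "orbit f x (k + int (Suc m)) = orbit f x ((k + int m) + 1)"
    by (simp add: algebra_simps)
  also have "\<dots> = (f ^^ Suc m) (orbit f x k)"
    unfolding orbit_Suc Suc by simp
  finally show ?case .
qed simp

lemma orbit_diff_nat: "orbit f x (k - int m) = (inv f ^^ m) (orbit f x k)"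
proof (induction m)
  case (Suc m)
  have "orbit f x (k - int (Suc m)) = inv f (orbit f x (k - int m))"
    by (simp add: algebra_simps)
  then show ?case
    unfolding Suc by simp
qed simp

lemma orbit_orbit: "orbit f (orbit f x j) k = orbit f x (j + k)"
proof (cases "k \<ge> 0")
  case True
  then show ?thesis
    using orbit_add_nat[of x j "nat k"] by (simp add: orbit_def[of f "orbit f x j"])
next
  case False
  then show ?thesis
    using orbit_diff_nat[of x j "nat (- k)"] by (simp add: orbit_def[of f "orbit f x j"])
qed

lemma Gamma_diff:
  "Gamma f xs (\<lambda>k. \<eta> k - \<zeta> k) = (\<lambda>k. Gamma f xs \<eta> k - Gamma f xs \<zeta> k)"
  using bounded_linear.linear[OF Dmap_linear] by (auto simp: Gamma_def linear_diff)

lemma Gamma_scaleR: "Gamma f xs (\<lambda>k. c *\<^sub>R \<eta> k) = (\<lambda>k. c *\<^sub>R Gamma f xs \<eta> k)"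
  using bounded_linear.linear[OF Dmap_linear] by (auto simp: Gamma_def linear_scale algebra_simps)

text \<open>Starting the orbit at another of its points conjugates \<open>Gamma\<close> by an index
  shift, so an estimate at index 0 can be carried to any index.\<close>

lemma Gamma_shift: "Gamma f (orbit f (orbit f x j)) (\<lambda>k. \<eta> (k + j)) = (\<lambda>k. Gamma f (orbit f x) \<eta> (k + j))"
  by (auto simp: Gamma_def orbit_orbit algebra_simps)

text \<open>The derivative is uniformly bounded and a shift by one index costs only the factor
  \<open>weight_rate n\<close>.\<close>

lemma Gamma_in_Xsp:
  assumes "\<eta> \<in> Xsp n"
  shows "Gamma f xs \<eta> \<in> Xsp n"
proof -
  obtain L where L: "L > 0" "\<And>x v. norm (Dmap f x v) \<le> L * norm v"
    using Dmap_norm_bound[OF C1] by blast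
  have "(\<lambda>k. Dmap f (xs (k - 1)) (\<eta> (k - 1))) \<in> Xsp n"
  proof (rule XspI)
    fix k
    have "norm (\<eta> (k - 1)) \<le> seqnorm n \<eta> / weight n k * weight_rate n"
      using Xsp_norm_le[OF assms, of k "k - 1" 1] by simp
    then have "norm (Dmap f (xs (k - 1)) (\<eta> (k - 1))) \<le> L * (seqnorm n \<eta> / weight n k * weight_rate n)"
      using L by (meson mult_left_mono less_imp_le order_trans)
    then show "weight n k * norm (Dmap f (xs (k - 1)) (\<eta> (k - 1))) \<le> L * (seqnorm n \<eta> * weight_rate n)"
      using weight_pos[of n k] by (simp add: field_simps)
  qed
  from Xsp_diff[OF assms this] show ?thesis
    by (simp add: Gamma_def)
qed

end

subsection \<open>From invertibility to hyperbolicity\<close>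

locale invariant_set = torus_diffeo f for f :: "'n::finite torus \<Rightarrow> 'n torus" +
  fixes \<Lambda> :: "'n torus set"
  assumes invariant: "f ` \<Lambda> = \<Lambda>"
begin

lemma f_in: "x \<in> \<Lambda> \<Longrightarrow> f x \<in> \<Lambda>"
  using invariant by blast

lemma inv_f_in: "x \<in> \<Lambda> \<Longrightarrow> inv f x \<in> \<Lambda>"
  using invariant inv_f by (metis imageE)

lemma orbit_in: "x \<in> \<Lambda> \<Longrightarrow> orbit f x k \<in> \<Lambda>"
proof -
  have "(f ^^ m) x \<in> \<Lambda>" "(inv f ^^ m) x \<in> \<Lambda>" if "x \<in> \<Lambda>" for m
    using that by (induction m) (auto intro: f_in inv_f_in)
  then show "x \<in> \<Lambda> \<Longrightarrow> orbit f x k \<in> \<Lambda>"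
    by (simp add: orbit_def)
qed

text \<open>The estimate at index \<open>0\<close> does not see the weights; shifting along the orbit, which stays in
  \<open>\<Lambda>\<close>, moves it to every index. So invertibility on \<open>X\<^sub>n\<close> controls bounded sequences.\<close>
lemma Gamma_cond_sup_estimate:
  assumes cond: "Gamma_cond f \<Lambda> n"
  obtains C where "C > 0"
    "\<And>x \<eta> s k. x \<in> \<Lambda> \<Longrightarrow> \<eta> \<in> Xsp n \<Longrightarrow> s > 0 \<Longrightarrow> (\<And>k. norm (Gamma f (orbit f x) \<eta> k) \<le> s) \<Longrightarrow>
      norm (\<eta> k) \<le> C * s"
proof -
  have inv: "has_cont_inverse n (Gamma f (orbit f x))" if "x \<in> \<Lambda>" for x
    using cond that by (auto simp: Gamma_cond_def)
  obtain C0 where "opnorm n (inv_into (Xsp n) (Gamma f (orbit f x))) \<le> C0" if "x \<in> \<Lambda>" for x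
    using cond by (auto simp: Gamma_cond_def bdd_above_def)
  then obtain C where C: "C > 0" "\<And>x. x \<in> \<Lambda> \<Longrightarrow> opnorm n (inv_into (Xsp n) (Gamma f (orbit f x))) \<le> C"
    using that[of "max C0 1"] by (meson max.coboundedI1 max.strict_coboundedI2 zero_less_one)
  have at_0: "norm (\<eta> 0) \<le> C * s"
    if x: "x \<in> \<Lambda>" and \<eta>: "\<eta> \<in> Xsp n" and s: "s > 0"
      and le: "\<And>k. norm (Gamma f (orbit f x) \<eta> k) \<le> s" for x \<eta> s
  proof -
    define \<zeta> where "\<zeta> = (\<lambda>k. (1 / s) *\<^sub>R \<eta> k)"
    have \<zeta>: "\<zeta> \<in> Xsp n"
      unfolding \<zeta>_def by (rule Xsp_scaleR[OF \<eta>])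
    have "norm (Gamma f (orbit f x) \<zeta> k) \<le> 1" for k
      unfolding \<zeta>_def Gamma_scaleR using le[of k] s by simp
    \<comment> \<open>Weights at most 1 let a uniform bound control the weighted norm; the weight 1
      at index 0 then reads off \<open>\<zeta> 0\<close>.\<close>
    then have "seqnorm n (Gamma f (orbit f x) \<zeta>) \<le> 1"
      using weight_le_1 weight_pos by (intro seqnorm_leI) (metis mult_le_one norm_ge_zero)
    then have "seqnorm n \<zeta> \<le> C"
      using has_cont_inverse_seqnorm_le_opnorm[OF inv[OF x] \<zeta>] C(2)[OF x] by simp
    then have "norm (\<zeta> 0) \<le> C"
      using weight_norm_le_seqnorm[OF \<zeta>, of 0] by simp
    then show ?thesis
      using s by (simp add: \<zeta>_def field_simps)
  qed
  have "norm (\<eta> j) \<le> C * s"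
    if x: "x \<in> \<Lambda>" and \<eta>: "\<eta> \<in> Xsp n" and s: "s > 0"
      and le: "\<And>k. norm (Gamma f (orbit f x) \<eta> k) \<le> s" for x \<eta> s j
    using at_0[OF orbit_in[OF x, of j] Xsp_shift[OF \<eta>, of j] s] le
    by (simp add: Gamma_shift)
  with C(1) show ?thesis
    using that by blast
qed

text \<open>Surjectivity gives a solution that is only known to lie in \<open>Xsp n\<close>; the
  uniform estimate shows that it is bounded.\<close>

lemma Gamma_cond_bounded_solution:
  assumes cond: "Gamma_cond f \<Lambda> n" and x: "x \<in> \<Lambda>" and \<zeta>: "\<And>k. norm (\<zeta> k) \<le> s"
  obtains \<eta> C where "Gamma f (orbit f x) \<eta> = \<zeta>" "\<And>k. norm (\<eta> k) \<le> C"
proof -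
  obtain C where C: "\<And>x \<eta> s k. x \<in> \<Lambda> \<Longrightarrow> \<eta> \<in> Xsp n \<Longrightarrow> s > 0 \<Longrightarrow>
      (\<And>k. norm (Gamma f (orbit f x) \<eta> k) \<le> s) \<Longrightarrow> norm (\<eta> k) \<le> C * s"
    using Gamma_cond_sup_estimate[OF cond] by metis
  have "bij_betw (Gamma f (orbit f x)) (Xsp n) (Xsp n)"
    using cond x by (auto simp: Gamma_cond_def has_cont_inverse_def)
  then obtain \<eta> where \<eta>: "\<eta> \<in> Xsp n" "Gamma f (orbit f x) \<eta> = \<zeta>"
    using bounded_in_Xsp[of \<zeta>, OF \<zeta>] by (metis bij_betw_imp_surj_on imageE)
  \<comment> \<open>The estimate asks for a positive bound, while \<open>s\<close> may be 0.\<close>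
  have "norm (\<zeta> k) \<le> max s 1" for k
    using \<zeta>[of k] by simp
  then have "norm (\<eta> k) \<le> C * max s 1" for k
    using C[OF x \<eta>(1), of "max s 1"] \<eta>(2) by simp
  with \<eta>(2) that show ?thesis by blast
qed

text \<open>The weights \<open>r\<^bsup>min |k| m\<^esup>\<close> are bounded and vary so slowly that multiplying by them perturbs
  \<open>\<Gamma>\<close> by less than half of its lower bound; let \<open>m\<close> tend to infinity.\<close>
lemma delta_solution_decay:
  assumes C: "C > 0" "\<And>\<eta> s k. \<eta> \<in> Xsp n \<Longrightarrow> s > 0 \<Longrightarrow> (\<And>k. norm (Gamma f xs \<eta> k) \<le> s) \<Longrightarrow> norm (\<eta> k) \<le> C * s"
    and r: "r > 1" "C * (r - 1) \<le> 1 / 2"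
    and \<eta>: "\<And>k. norm (\<eta> k) \<le> B"
    and delta: "\<And>k. Gamma f xs \<eta> k = (if k = 0 then v else 0)"
  shows "r ^ nat \<bar>j\<bar> * norm (\<eta> j) \<le> 2 * C * r * norm v"
proof -
  \<comment> \<open>Truncating here keeps the weights bounded and still gives index \<open>j\<close>
    its full factor.\<close>
  define m where "m = nat \<bar>j\<bar>"
  define w where "w k = r ^ min (nat \<bar>k\<bar>) m" for k
  have w_pos: "w k > 0" for k
    using r(1) by (simp add: w_def)
  have w_le: "w k \<le> r ^ m" for k
    using r(1) by (simp add: w_def power_increasing)
  have r_mono: "r ^ a \<le> r * r ^ b" if "a \<le> Suc b" for a b
    using power_increasing[OF that, of r] r(1) by simp
  have w1: "w (k - 1) \<le> r * w k" and w2: "w k \<le> r * w (k - 1)" for k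
    unfolding w_def by (intro r_mono; linarith)+
  have w_diff: "\<bar>w k - w (k - 1)\<bar> \<le> (r - 1) * w k" for k
  proof -
    have "w k - w (k - 1) \<le> (r - 1) * w k"
    proof (cases "w (k - 1) \<le> w k")
      case True
      then have "(r - 1) * w (k - 1) \<le> (r - 1) * w k"
        using r(1) by (intro mult_left_mono) auto
      then show ?thesis using w2[of k] by (simp add: algebra_simps)
    next
      case False
      then have "w k - w (k - 1) \<le> 0" by simp
      also have "0 \<le> (r - 1) * w k" using r(1) w_pos[of k] by simp
      finally show ?thesis .
    qed
    then show ?thesis using w1[of k] by (simp add: abs_le_iff algebra_simps)
  qed
  define \<zeta> where "\<zeta> = (\<lambda>k. w k *\<^sub>R \<eta> k)"
  have \<zeta>_le: "norm (\<zeta> k) \<le> r ^ m * B" for k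
    unfolding \<zeta>_def using mult_mono[OF w_le \<eta>] w_pos[of k] r(1) by simp
  have D: "Dmap f (xs (k - 1)) (\<eta> (k - 1)) = \<eta> k - (if k = 0 then v else 0)" for k
    using delta[of k] by (auto simp: Gamma_def algebra_simps)
  \<comment> \<open>Eliminating the derivative through the equation for \<open>\<eta>\<close> leaves
    only the variation of the weights, relative to \<open>w k\<close>, and the source at index
    0.\<close>
  have G: "Gamma f xs \<zeta> k = (w k - w (k - 1)) *\<^sub>R \<eta> k + w (k - 1) *\<^sub>R (if k = 0 then v else 0)" for k
  proof -
    have "Gamma f xs \<zeta> k = w k *\<^sub>R \<eta> k - w (k - 1) *\<^sub>R Dmap f (xs (k - 1)) (\<eta> (k - 1))"
      using bounded_linear.linear[OF Dmap_linear] by (simp add: Gamma_def \<zeta>_def linear_scale)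
    then show ?thesis
      unfolding D by (simp add: algebra_simps)
  qed
  define S where "S = (SUP k. norm (\<zeta> k))"
  have bdd: "bdd_above (range (\<lambda>k. norm (\<zeta> k)))"
    by (rule bdd_aboveI2) (rule \<zeta>_le)
  have S_ge: "norm (\<zeta> k) \<le> S" for k
    unfolding S_def by (intro cSUP_upper bdd) auto
  have "S \<ge> 0" using S_ge[of 0] norm_ge_zero order_trans by blast
  have "norm (Gamma f xs \<zeta> k) \<le> (r - 1) * S + r * norm v" for k
  proof -
    have "norm ((w k - w (k - 1)) *\<^sub>R \<eta> k) \<le> (r - 1) * w k * norm (\<eta> k)"
      using w_diff[of k] by (simp add: mult_right_mono)
    also have "\<dots> = (r - 1) * norm (\<zeta> k)"
      using w_pos[of k] by (simp add: \<zeta>_def)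
    also have "\<dots> \<le> (r - 1) * S"
      using S_ge[of k] r(1) by (intro mult_left_mono) auto
    finally have 1: "norm ((w k - w (k - 1)) *\<^sub>R \<eta> k) \<le> (r - 1) * S" .
    have "w (-1) \<le> r"
      using w1[of 0] by (simp add: w_def)
    then have 2: "norm (w (k - 1) *\<^sub>R (if k = 0 then v else 0)) \<le> r * norm v"
      using w_pos[of "-1"] r(1) by (simp add: mult_right_mono)
    show ?thesis
      unfolding G by (rule order_trans[OF norm_triangle_ineq add_mono[OF 1 2]])
  qed
  \<comment> \<open>The summand \<open>e\<close> makes the bound strictly positive, as the
    hypothesis on \<open>C\<close> requires; it is let go to 0 afterwards.\<close>
  then have le: "norm (Gamma f xs \<zeta> k) \<le> (r - 1) * S + r * norm v + e" if "e > 0" for e k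
    using that by (smt (verit))
  have "S \<le> C * ((r - 1) * S + r * norm v + e)" if "e > 0" for e
    unfolding S_def
  proof (rule cSUP_least)
    fix k
    show "norm (\<zeta> k) \<le> C * ((r - 1) * (SUP k. norm (\<zeta> k)) + r * norm v + e)"
      using C(2)[of \<zeta> "(r - 1) * S + r * norm v + e" k, OF bounded_in_Xsp[of \<zeta>, OF \<zeta>_le] _ le[OF that]]
        that r(1) \<open>S \<ge> 0\<close> unfolding S_def[symmetric] by (simp add: add_nonneg_pos)
  qed simp
  from this[of "e / C" for e] have "S \<le> C * ((r - 1) * S + r * norm v) + e" if "e > 0" for e
    using that C(1) by (simp add: distrib_left)
  then have "S \<le> C * ((r - 1) * S + r * norm v)"
    by (rule field_le_epsilon)
  \<comment> \<open>Half of \<open>S\<close> is absorbed into the left-hand side, which is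
    legitimate because the truncation makes \<open>S\<close> a true finite supremum.\<close>
  moreover have "C * (r - 1) * S \<le> 1 / 2 * S"
    using r(2) \<open>S \<ge> 0\<close> by (rule mult_right_mono)
  ultimately have "S \<le> 2 * C * r * norm v"
    by (simp add: algebra_simps)
  moreover have "r ^ m * norm (\<eta> j) = norm (\<zeta> j)"
    using r(1) by (simp add: \<zeta>_def w_def m_def)
  ultimately show ?thesis
    using S_ge[of j] unfolding m_def by linarith
qed

section \<open>Stable and unstable spaces\<close>

text \<open>Asking for boundedness rather than decay makes linearity and invariance immediate; decay
  is recovered from \<open>delta_solution_decay\<close>.\<close>

definition stable_space :: "'n torus \<Rightarrow> (real^'n) set" where
  "stable_space x = {v. \<exists>K. \<forall>m. norm (Dpow f m x v) \<le> K}"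

definition unstable_space :: "'n torus \<Rightarrow> (real^'n) set" where
  "unstable_space x = {v. \<exists>K. \<forall>m. norm (Dpow (inv f) m x v) \<le> K}"

text \<open>Passing to the image drops the first term of the forward orbit, which does not affect
  boundedness.\<close>

lemma stable_space_f_iff: "Dmap f x v \<in> stable_space (f x) \<longleftrightarrow> v \<in> stable_space x"
  using bounded_Suc_iff[of "\<lambda>m. Dpow f m x v"]
  by (simp add: stable_space_def Dpow_Suc_shift del: Dpow.simps)

lemma unstable_space_f_iff: "Dmap f x v \<in> unstable_space (f x) \<longleftrightarrow> v \<in> unstable_space x"
  using bounded_Suc_iff[of "\<lambda>m. Dpow (inv f) m (f x) (Dmap f x v)"]
  by (simp add: unstable_space_def Dpow_Suc_shift del: Dpow.simps)

lemma Dmap_image_eq: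
  assumes "\<And>v. Dmap f x v \<in> E' \<longleftrightarrow> v \<in> E"
  shows "Dmap f x ` E = E'"
proof
  show "E' \<subseteq> Dmap f x ` E"
  proof
    fix w assume "w \<in> E'"
    then show "w \<in> Dmap f x ` E"
      using assms[of "Dmap (inv f) (f x) w"] by (intro image_eqI[where x = "Dmap (inv f) (f x) w"]) auto
  qed
qed (use assms in auto)

lemma Dmap_Dmap_inv': "Dmap f (inv f y) (Dmap (inv f) y v) = v"
  using Dmap_Dmap_inv[of "inv f y" v] by simp

section \<open>Solutions with a source at index 0\<close>

definition forward_orbit :: "'n torus \<Rightarrow> real^'n \<Rightarrow> int \<Rightarrow> real^'n" where
  "forward_orbit x v k = (if k \<ge> 0 then Dpow f (nat k) x v else 0)"

text \<open>The sign, and the value 0 at index 0, are chosen so that the source is \<open>v\<close>,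
  exactly as for \<open>forward_orbit\<close>.\<close>

definition backward_orbit :: "'n torus \<Rightarrow> real^'n \<Rightarrow> int \<Rightarrow> real^'n" where
  "backward_orbit x v k = (if k < 0 then - Dpow (inv f) (nat (- k)) x v else 0)"

lemma Gamma_forward_orbit: "Gamma f (orbit f x) (forward_orbit x v) k = (if k = 0 then v else 0)"
proof -
  consider "k < 0" | "k = 0" | m where "k = int (Suc m)"
  proof (cases "k > 0")
    case True
    then have "k = int (Suc (nat (k - 1)))" by simp
    then show ?thesis by (rule that(3))
  qed (use that in linarith)
  then show ?thesis
  proof cases
    case (3 m)
    then show ?thesis
      by (simp add: Gamma_def forward_orbit_def orbit_def nat_add_distrib)
  qed (use bounded_linear.linear[OF Dmap_linear] in \<open>auto simp: Gamma_def forward_orbit_def linear_0\<close>)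
qed

lemma Gamma_backward_orbit: "Gamma f (orbit f x) (backward_orbit x v) k = (if k = 0 then v else 0)"
proof (cases "k > 0")
  case True
  then show ?thesis
    using bounded_linear.linear[OF Dmap_linear] by (auto simp: Gamma_def backward_orbit_def linear_0)
next
  case False
  define m where "m = nat (- k)"
  have k: "k = - int m" "nat (- (k - 1)) = Suc m"
    using False by (auto simp: m_def)
  have "(inv f ^^ m) x = orbit f x k"
    using orbit_diff_nat[of x 0 m] by (simp add: k(1))
  then have "Dmap f (orbit f x (k - 1)) (Dpow (inv f) (Suc m) x v) = Dpow (inv f) m x v"
    using Dmap_Dmap_inv'[of "orbit f x k"] by simp
  then have "Dmap f (orbit f x (k - 1)) (backward_orbit x v (k - 1)) = - Dpow (inv f) m x v"
    using False k(2) bounded_linear.linear[OF Dmap_linear]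
    by (simp add: backward_orbit_def linear_neg del: Dpow.simps)
  then show ?thesis
    using False by (cases "k = 0") (auto simp: Gamma_def backward_orbit_def m_def)
qed

lemma forward_orbit_bounded:
  assumes "v \<in> stable_space x"
  shows "\<exists>S. \<forall>k. norm (forward_orbit x v k) \<le> S"
proof -
  obtain S where S: "norm (Dpow f m x v) \<le> S" for m
    using assms by (auto simp: stable_space_def)
  then have "norm (forward_orbit x v k) \<le> S" for k
    using order_trans[OF norm_ge_zero S[of 0]] by (simp add: forward_orbit_def)
  then show ?thesis by blast
qed

lemma backward_orbit_bounded:
  assumes "v \<in> unstable_space x"
  shows "\<exists>S. \<forall>k. norm (backward_orbit x v k) \<le> S"
proof -
  obtain S where S: "norm (Dpow (inv f) m x v) \<le> S" for m
    using assms by (auto simp: unstable_space_def)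
  then have "norm (backward_orbit x v k) \<le> S" for k
    using order_trans[OF norm_ge_zero S[of 0]] by (simp add: backward_orbit_def)
  then show ?thesis by blast
qed

text \<open>Away from index 0 the solution is an orbit of the derivative cocycle. It leaves index 0
  with the value \<open>\<eta> 0\<close> but arrives there from the past with
  \<open>\<eta> 0 - v\<close>.\<close>

lemma delta_solution_splitting:
  assumes \<eta>: "\<And>k. norm (\<eta> k) \<le> S"
    and delta: "\<And>k. Gamma f (orbit f x) \<eta> k = (if k = 0 then v else 0)"
  shows "\<eta> 0 \<in> stable_space x" "v - \<eta> 0 \<in> unstable_space x"
proof -
  have D: "Dmap f (orbit f x (k - 1)) (\<eta> (k - 1)) = \<eta> k - (if k = 0 then v else 0)" for k
    using delta[of k] by (auto simp: Gamma_def algebra_simps)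
  have "Dpow f m x (\<eta> 0) = \<eta> (int m)" for m
  proof (induction m)
    case (Suc m)
    then show ?case
      using D[of "1 + int m"] orbit_add_nat[of x 0 m] by simp
  qed simp
  then show "\<eta> 0 \<in> stable_space x"
    using \<eta> by (auto simp: stable_space_def)
  \<comment> \<open>The identity starts one step back, since at index 0 the jump by \<open>v\<close>
    intervenes; \<open>bounded_Suc_iff\<close> supplies the missing term.\<close>
  have "Dpow (inv f) (Suc m) x (v - \<eta> 0) = - \<eta> (- int (Suc m))" for m
  proof (induction m)
    case 0
    have "v - \<eta> 0 = Dmap f (inv f x) (- \<eta> (- 1))"
      using D[of 0] inv_orbit[of x 0] bounded_linear.linear[OF Dmap_linear] by (simp add: linear_neg)
    then show ?case
      using Dmap_inv_Dmap[of "inv f x" "- \<eta> (- 1)"] by simp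
  next
    case (Suc m)
    define y where "y = orbit f x (- int (Suc m))"
    have y: "(inv f ^^ Suc m) x = y"
      unfolding y_def using orbit_diff_nat[of x 0 "Suc m"] by (simp only: diff_0 orbit_0)
    have y': "orbit f x (- int (Suc m) - 1) = inv f y"
      unfolding y_def by (rule inv_orbit[symmetric])
    have "- \<eta> (- int (Suc m)) = Dmap f (inv f y) (- \<eta> (- int (Suc m) - 1))"
      using D[of "- int (Suc m)"] bounded_linear.linear[OF Dmap_linear] unfolding y'
      by (simp add: linear_neg)
    then have "Dmap (inv f) y (- \<eta> (- int (Suc m))) = - \<eta> (- int (Suc m) - 1)"
      using Dmap_inv_Dmap[of "inv f y"] by simp
    moreover have "Dpow (inv f) (Suc (Suc m)) x (v - \<eta> 0) = Dmap (inv f) y (- \<eta> (- int (Suc m)))"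
      unfolding Dpow.simps(2)[of "inv f" "Suc m"] y o_def Suc ..
    ultimately show ?case by simp
  qed
  then have "\<forall>m. norm (Dpow (inv f) (Suc m) x (v - \<eta> 0)) \<le> S"
    using \<eta> by (metis norm_minus_cancel)
  then show "v - \<eta> 0 \<in> unstable_space x"
    unfolding unstable_space_def mem_Collect_eq bounded_Suc_iff[of "\<lambda>m. Dpow (inv f) m x (v - \<eta> 0)", symmetric]
    by blast
qed

lemma Gamma_cond_imp_unif_hyperbolic:
  assumes cond: "Gamma_cond f \<Lambda> n"
  shows "unif_hyperbolic f \<Lambda>"
proof -
  obtain C where C: "C > 0"
    "\<And>x \<eta> s k. x \<in> \<Lambda> \<Longrightarrow> \<eta> \<in> Xsp n \<Longrightarrow> s > 0 \<Longrightarrow> (\<And>k. norm (Gamma f (orbit f x) \<eta> k) \<le> s) \<Longrightarrow>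
      norm (\<eta> k) \<le> C * s"
    using Gamma_cond_sup_estimate[OF cond] by metis
  \<comment> \<open>This gives \<open>C * (r - 1) = 1 / 2\<close>, the largest growth that
    \<open>delta_solution_decay\<close> admits; \<open>1 / r\<close> becomes the contraction
    rate.\<close>
  define r where "r = 1 + 1 / (2 * C)"
  have r: "r > 1" "C * (r - 1) \<le> 1 / 2"
    using C(1) by (auto simp: r_def)
  have power_r: "2 * C * r * (1 / r) ^ m * b = 2 * C * r * b / r ^ m" for m b
    by (simp add: power_divide)
  have stable: "norm (Dpow f m x v) \<le> 2 * C * r * (1 / r) ^ m * norm v"
    if x: "x \<in> \<Lambda>" and v: "v \<in> stable_space x" for x v m
  proof -
    obtain S where S: "\<And>k. norm (forward_orbit x v k) \<le> S"
      using forward_orbit_bounded[OF v] by blast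
    have "r ^ nat \<bar>int m\<bar> * norm (forward_orbit x v (int m)) \<le> 2 * C * r * norm v"
      by (rule delta_solution_decay[where n = n and xs = "orbit f x" and B = S, OF C(1) _ r S Gamma_forward_orbit])
        (rule C(2)[OF x])
    then show ?thesis
      unfolding power_r using r(1) by (simp add: forward_orbit_def field_simps)
  qed
  have unstable: "norm (Dpow (inv f) m x v) \<le> 2 * C * r * (1 / r) ^ m * norm v"
    if x: "x \<in> \<Lambda>" and v: "v \<in> unstable_space x" and "m > 0" for x v m
  proof -
    obtain S where S: "\<And>k. norm (backward_orbit x v k) \<le> S"
      using backward_orbit_bounded[OF v] by blast
    have "r ^ nat \<bar>- int m\<bar> * norm (backward_orbit x v (- int m)) \<le> 2 * C * r * norm v"
      by (rule delta_solution_decay[where n = n and xs = "orbit f x" and B = S, OF C(1) _ r S Gamma_backward_orbit])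
        (rule C(2)[OF x])
    then show ?thesis
      unfolding power_r using r(1) \<open>m > 0\<close> by (simp add: backward_orbit_def field_simps)
  qed
  have inter: "v = 0" if x: "x \<in> \<Lambda>" and v: "v \<in> stable_space x" "v \<in> unstable_space x" for x v
  proof -
    \<comment> \<open>Equal sources cancel, so this is a bounded full orbit with value
      \<open>v\<close> at index 0, lying in the kernel of \<open>Gamma\<close>.\<close>
    define \<eta> where "\<eta> = (\<lambda>k. forward_orbit x v k - backward_orbit x v k)"
    obtain S1 S2 where "\<And>k. norm (forward_orbit x v k) \<le> S1" "\<And>k. norm (backward_orbit x v k) \<le> S2"
      using forward_orbit_bounded[OF v(1)] backward_orbit_bounded[OF v(2)] by metis
    then have "\<eta> \<in> Xsp n"
      unfolding \<eta>_def by (intro Xsp_diff bounded_in_Xsp)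
    moreover have "Gamma f (orbit f x) \<eta> k = 0" for k
      unfolding \<eta>_def Gamma_diff by (simp add: Gamma_forward_orbit Gamma_backward_orbit)
    ultimately have "norm (\<eta> 0) \<le> C * s" if "s > 0" for s
      using C(2)[OF x, of \<eta> s 0] that by simp
    from this[of "e / C" for e] have "norm (\<eta> 0) \<le> 0 + e" if "e > 0" for e
      using that C(1) by simp
    then have "norm (\<eta> 0) \<le> 0"
      by (rule field_le_epsilon)
    then show ?thesis
      by (simp add: \<eta>_def forward_orbit_def backward_orbit_def)
  qed
  have split: "\<exists>a\<in>stable_space x. \<exists>b\<in>unstable_space x. v = a + b" if x: "x \<in> \<Lambda>" for x v
  proof -
    have le: "norm (if k = 0 then v else 0) \<le> norm v" for k :: int
      by simp
    obtain \<eta> S where \<eta>: "Gamma f (orbit f x) \<eta> = (\<lambda>k. if k = 0 then v else 0)" "\<And>k. norm (\<eta> k) \<le> S"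
      by (rule Gamma_cond_bounded_solution[OF cond x, where \<zeta> = "\<lambda>k. if k = 0 then v else 0", OF le])
        (rule that)
    have "\<eta> 0 \<in> stable_space x" "v - \<eta> 0 \<in> unstable_space x"
      by (rule delta_solution_splitting[OF \<eta>(2)], simp add: \<eta>(1))+
    moreover have "v = \<eta> 0 + (v - \<eta> 0)"
      by simp
    ultimately show ?thesis by blast
  qed
  have sub: "subspace (stable_space x)" "subspace (unstable_space x)" for x
    unfolding stable_space_def unstable_space_def
    by (rule subspace_bounded_Dpow[OF C1] subspace_bounded_Dpow[OF C1_inv])+
  show ?thesis
    unfolding unif_hyperbolic_def
  proof (intro exI conjI ballI allI impI)
    show "0 < 2 * C * r" "0 < 1 / r" "1 / r < 1"
      using C(1) r(1) by auto
    fix x assume x: "x \<in> \<Lambda>"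
    show "stable_space x \<inter> unstable_space x = {0}"
      using inter[OF x] sub[THEN subspace_0] by blast
    show "Dmap f x ` stable_space x = stable_space (f x)"
      by (rule Dmap_image_eq[OF stable_space_f_iff])
    show "Dmap f x ` unstable_space x = unstable_space (f x)"
      by (rule Dmap_image_eq[OF unstable_space_f_iff])
  qed (use sub split stable unstable in auto)
qed

end

subsection \<open>From hyperbolicity to invertibility\<close>

locale hyperbolic_set = invariant_set f \<Lambda> for f :: "'n::finite torus \<Rightarrow> 'n torus" and \<Lambda> +
  fixes c lam :: real and Es Eu :: "'n torus \<Rightarrow> (real^'n) set"
  assumes c_pos: "c > 0" and lam: "0 < lam" "lam < 1"
    and subspaces: "\<And>x. x \<in> \<Lambda> \<Longrightarrow> subspace (Es x)" "\<And>x. x \<in> \<Lambda> \<Longrightarrow> subspace (Eu x)"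
    and inter: "\<And>x. x \<in> \<Lambda> \<Longrightarrow> Es x \<inter> Eu x = {0}"
    and split: "\<And>x v. x \<in> \<Lambda> \<Longrightarrow> \<exists>a\<in>Es x. \<exists>b\<in>Eu x. v = a + b"
    and Es_image: "\<And>x. x \<in> \<Lambda> \<Longrightarrow> Dmap f x ` Es x = Es (f x)"
    and Eu_image: "\<And>x. x \<in> \<Lambda> \<Longrightarrow> Dmap f x ` Eu x = Eu (f x)"
    and contract: "\<And>x k v. x \<in> \<Lambda> \<Longrightarrow> k > 0 \<Longrightarrow> v \<in> Es x \<Longrightarrow> norm (Dpow f k x v) \<le> c * lam ^ k * norm v"
    and expand: "\<And>x k v. x \<in> \<Lambda> \<Longrightarrow> k > 0 \<Longrightarrow> v \<in> Eu x \<Longrightarrow> norm (Dpow (inv f) k x v) \<le> c * lam ^ k * norm v"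
begin

section \<open>Projections along the splitting\<close>

text \<open>The projection onto \<open>Es x\<close> along \<open>Eu x\<close>, encoded by choice;
  for \<open>x\<close> in \<open>\<Lambda>\<close> it is determined by \<open>proj_in\<close> and
  \<open>proj_unique\<close>.\<close>

definition proj :: "'n torus \<Rightarrow> real^'n \<Rightarrow> real^'n" where
  "proj x v = (SOME a. a \<in> Es x \<and> v - a \<in> Eu x)"

lemma proj_in:
  assumes "x \<in> \<Lambda>"
  shows "proj x v \<in> Es x" "v - proj x v \<in> Eu x"
proof -
  obtain a b where "a \<in> Es x" "b \<in> Eu x" "v = a + b"
    using split[OF assms] by blast
  then have "a \<in> Es x \<and> v - a \<in> Eu x" by simp
  then have "proj x v \<in> Es x \<and> v - proj x v \<in> Eu x"
    unfolding proj_def by (rule someI)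
  then show "proj x v \<in> Es x" "v - proj x v \<in> Eu x" by auto
qed

lemma proj_unique:
  assumes x: "x \<in> \<Lambda>" and a: "a \<in> Es x" "v - a \<in> Eu x"
  shows "proj x v = a"
proof -
  have "proj x v - a \<in> Es x"
    using subspace_diff[OF subspaces(1)[OF x] proj_in(1)[OF x] a(1)] .
  moreover have "(v - a) - (v - proj x v) \<in> Eu x"
    using subspace_diff[OF subspaces(2)[OF x] a(2) proj_in(2)[OF x]] .
  then have "proj x v - a \<in> Eu x" by simp
  ultimately have "proj x v - a \<in> Es x \<inter> Eu x" ..
  then show ?thesis
    unfolding inter[OF x] by simp
qed

lemma funpow_in: "x \<in> \<Lambda> \<Longrightarrow> (f ^^ m) x \<in> \<Lambda>"
  by (induction m) (auto intro: f_in)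

lemma Dpow_in:
  assumes "x \<in> \<Lambda>"
  shows "v \<in> Es x \<Longrightarrow> Dpow f m x v \<in> Es ((f ^^ m) x)" "v \<in> Eu x \<Longrightarrow> Dpow f m x v \<in> Eu ((f ^^ m) x)"
proof -
  have step: "Dmap f y v \<in> Es (f y)" if "y \<in> \<Lambda>" "v \<in> Es y" for y v
    using Es_image[OF that(1)] that(2) by blast
  show "v \<in> Es x \<Longrightarrow> Dpow f m x v \<in> Es ((f ^^ m) x)"
    by (induction m) (auto intro: step funpow_in assms)
  have step: "Dmap f y v \<in> Eu (f y)" if "y \<in> \<Lambda>" "v \<in> Eu y" for y v
    using Eu_image[OF that(1)] that(2) by blast
  show "v \<in> Eu x \<Longrightarrow> Dpow f m x v \<in> Eu ((f ^^ m) x)"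
    by (induction m) (auto intro: step funpow_in assms)
qed

lemma Dpow_diff: "Dpow f m x (v - w) = Dpow f m x v - Dpow f m x w"
  using bounded_linear.linear[OF Dpow_linear[OF C1]] by (simp add: linear_diff)

text \<open>Both subspaces are invariant, so the image of a decomposition is the decomposition of
  the image.\<close>

lemma proj_Dpow:
  assumes "x \<in> \<Lambda>"
  shows "proj ((f ^^ m) x) (Dpow f m x v) = Dpow f m x (proj x v)"
proof (rule proj_unique[OF funpow_in[OF assms]])
  show "Dpow f m x (proj x v) \<in> Es ((f ^^ m) x)"
    by (rule Dpow_in(1)[OF assms proj_in(1)[OF assms]])
  show "Dpow f m x v - Dpow f m x (proj x v) \<in> Eu ((f ^^ m) x)"
    using Dpow_in(2)[OF assms proj_in(2)[OF assms]] by (simp only: Dpow_diff)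
qed

text \<open>The angle between the subspaces is bounded below without appeal to compactness: after \<open>k\<close> steps
  with \<open>c lam\<^sup>k \<le> 1/2\<close>, stable vectors are halved and unstable ones doubled, while
  \<open>Df\<^sup>k\<close> is bounded.\<close>
lemma proj_bound:
  obtains K where "K > 0" "\<And>x v. x \<in> \<Lambda> \<Longrightarrow> norm (proj x v) \<le> K * norm v"
    "\<And>x v. x \<in> \<Lambda> \<Longrightarrow> norm (v - proj x v) \<le> K * norm v"
proof -
  obtain L where L: "L > 0" "\<And>x v. norm (Dmap f x v) \<le> L * norm v"
    using Dmap_norm_bound[OF C1] by blast
  obtain k0 where k0: "lam ^ k0 < 1 / (2 * c)"
    using real_arch_pow_inv[of "1 / (2 * c)" lam] c_pos lam by auto
  \<comment> \<open>The hyperbolicity estimates are given for positive exponents only.\<close>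
  define k where "k = Suc k0"
  have "lam ^ k \<le> lam ^ k0"
    using lam unfolding k_def by (intro power_decreasing) auto
  then have "c * lam ^ k \<le> c * (1 / (2 * c))"
    using k0 c_pos by (intro mult_left_mono) auto
  then have k: "k > 0" "c * lam ^ k \<le> 1 / 2"
    using c_pos by (auto simp: k_def)
  define K where "K = L ^ k + 2"
  have main: "norm b \<le> (K - 1) * norm v \<and> norm a \<le> K * norm v"
    if x: "x \<in> \<Lambda>" and a: "a \<in> Es x" and b: "b \<in> Eu x" and v: "v = a + b" for x a b v
  proof -
    have "norm (Dpow f k x a) \<le> c * lam ^ k * norm a"
      by (rule contract[OF x k(1) a])
    also have "\<dots> \<le> 1 / 2 * norm a"
      using k(2) by (rule mult_right_mono) simp
    finally have 1: "norm (Dpow f k x a) \<le> 1 / 2 * norm a" .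
    have "norm (Dpow (inv f) k ((f ^^ k) x) (Dpow f k x b)) \<le> c * lam ^ k * norm (Dpow f k x b)"
      by (rule expand[OF funpow_in[OF x] k(1) Dpow_in(2)[OF x b]])
    also have "\<dots> \<le> 1 / 2 * norm (Dpow f k x b)"
      using k(2) by (rule mult_right_mono) simp
    finally have 2: "norm b \<le> 1 / 2 * norm (Dpow f k x b)"
      by (simp add: Dpow_inv_Dpow)
    have "Dpow f k x b = Dpow f k x v - Dpow f k x a"
      unfolding v by (simp flip: Dpow_diff)
    then have 3: "norm (Dpow f k x b) \<le> L ^ k * norm v + norm (Dpow f k x a)"
      using norm_triangle_ineq4[of "Dpow f k x v" "Dpow f k x a"] Dpow_norm_bound[OF L(2), of k x v] L(1) by simp
    have "norm a \<le> norm v + norm b" "norm v \<ge> 0" "L ^ k * norm v \<ge> 0"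
      using norm_triangle_ineq4[of v b] L(1) by (auto simp: v)
    \<comment> \<open>Inserting the bound for \<open>norm a\<close> into the one for
      \<open>norm b\<close> leaves \<open>norm b\<close> with coefficient 1/4 on the right, which is
      absorbed.\<close>
    with 1 2 3 have "norm b \<le> L ^ k * norm v + norm v" "norm a \<le> L ^ k * norm v + 2 * norm v"
      by linarith+
    then show ?thesis
      by (simp add: K_def algebra_simps)
  qed
  have "K > 0"
    using L(1) by (simp add: K_def add_pos_pos)
  moreover have "norm (proj x v) \<le> K * norm v" "norm (v - proj x v) \<le> K * norm v" if "x \<in> \<Lambda>" for x v
    using main[OF that proj_in[OF that, of v], of v] mult_right_mono[of "K - 1" K "norm v"] by auto
  ultimately show ?thesis
    by (rule that)
qed

text \<open>The norms of the projections are absorbed into the constant, so the estimates hold for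
  all vectors, and for \<open>m = 0\<close> as well.\<close>

lemma dichotomy:
  obtains D where "D > 0"
    "\<And>x m v. x \<in> \<Lambda> \<Longrightarrow> norm (Dpow f m x (proj x v)) \<le> D * lam ^ m * norm v"
    "\<And>x m v. x \<in> \<Lambda> \<Longrightarrow> norm (Dpow (inv f) m x (v - proj x v)) \<le> D * lam ^ m * norm v"
proof -
  obtain K where K: "K > 0" "\<And>x v. x \<in> \<Lambda> \<Longrightarrow> norm (proj x v) \<le> K * norm v"
    "\<And>x v. x \<in> \<Lambda> \<Longrightarrow> norm (v - proj x v) \<le> K * norm v"
    by (rule proj_bound) (rule that)
  \<comment> \<open>The maximum covers \<open>m = 0\<close>, since \<open>c\<close> may be less than
    1.\<close>
  define D where "D = max c 1 * K"
  have rate: "s \<le> D * lam ^ m * norm v"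
    if "m > 0 \<Longrightarrow> s \<le> c * lam ^ m * t" "m = 0 \<Longrightarrow> s = t" "t \<le> K * norm v" "0 \<le> t" for m s t and v :: "real^'n"
  proof -
    have "c * lam ^ m * t \<le> max c 1 * lam ^ m * t"
      using lam that(4) by (intro mult_right_mono) auto
    then have "s \<le> max c 1 * lam ^ m * t"
      using that(1,2,4) mult_right_mono[of 1 "max c 1" t] by (cases "m = 0") auto
    also have "\<dots> \<le> max c 1 * lam ^ m * (K * norm v)"
      using lam that(3) by (intro mult_left_mono) auto
    finally show ?thesis by (simp add: D_def algebra_simps)
  qed
  show ?thesis
  proof (rule that)
    show "D > 0" using K(1) by (simp add: D_def)
    show "norm (Dpow f m x (proj x v)) \<le> D * lam ^ m * norm v" if "x \<in> \<Lambda>" for x m v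
      using that by (intro rate[of m _ "norm (proj x v)"] contract K proj_in) auto
    show "norm (Dpow (inv f) m x (v - proj x v)) \<le> D * lam ^ m * norm v" if "x \<in> \<Lambda>" for x m v
      using that by (intro rate[of m _ "norm (v - proj x v)"] expand K proj_in) auto
  qed
qed

section \<open>The Green series\<close>

text \<open>A term from distance \<open>m\<close> shrinks by \<open>lam ^ m\<close> and gains at
  most \<open>weight_rate n ^ m\<close> from the weights, so both halves of the series are dominated
  by a geometric one; the two halves account for the factor 2.\<close>

lemma Gamma_invertible:
  assumes D: "D > 0"
      "\<And>x m v. x \<in> \<Lambda> \<Longrightarrow> norm (Dpow f m x (proj x v)) \<le> D * lam ^ m * norm v"
      "\<And>x m v. x \<in> \<Lambda> \<Longrightarrow> norm (Dpow (inv f) m x (v - proj x v)) \<le> D * lam ^ m * norm v"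
    and rate: "lam * weight_rate n < 1" and x: "x \<in> \<Lambda>"
  shows "bij_betw (Gamma f (orbit f x)) (Xsp n) (Xsp n)"
    and "\<eta> \<in> Xsp n \<Longrightarrow> seqnorm n \<eta> \<le> 2 * D / (1 - lam * weight_rate n) * seqnorm n (Gamma f (orbit f x) \<eta>)"
proof -
  define q where "q = lam * weight_rate n"
  have q: "0 \<le> q" "q < 1"
    using rate lam weight_rate_ge_1[of n] by (auto simp: q_def)
  define M where "M \<zeta> k = D * seqnorm n \<zeta> / weight n k" for \<zeta> :: "int \<Rightarrow> real^'n" and k
  have bound: "D * lam ^ m * norm (\<zeta> j) \<le> M \<zeta> k * q ^ m"
    if "\<zeta> \<in> Xsp n" "\<bar>k - j\<bar> \<le> int m" for \<zeta> :: "int \<Rightarrow> real^'n" and j k m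
  proof -
    have "D * lam ^ m * norm (\<zeta> j) \<le> D * lam ^ m * (seqnorm n \<zeta> / weight n k * weight_rate n ^ m)"
      using D(1) lam by (intro mult_left_mono Xsp_norm_le that) auto
    then show ?thesis
      by (simp add: M_def q_def power_mult_distrib algebra_simps)
  qed
  \<comment> \<open>\<open>S\<close> carries stable parts from the past forward to index
    \<open>k\<close>, and \<open>U\<close> below carries unstable parts from the future back to
    it.\<close>
  define S where "S \<zeta> k m = Dpow f m (orbit f x (k - int m)) (proj (orbit f x (k - int m)) (\<zeta> (k - int m)))"
    for \<zeta> k m
  define U where "U \<zeta> k m = Dpow (inv f) m (orbit f x (k + int m))
    (\<zeta> (k + int m) - proj (orbit f x (k + int m)) (\<zeta> (k + int m)))" for \<zeta> k m
  have S_le: "norm (S \<zeta> k m) \<le> M \<zeta> k * q ^ m" if "\<zeta> \<in> Xsp n" for \<zeta> k m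
    unfolding S_def using D(2)[OF orbit_in[OF x]] bound[OF that, of k "k - int m" m]
    by (rule order_trans) simp
  have U_le: "norm (U \<zeta> k m) \<le> M \<zeta> k * q ^ m" if "\<zeta> \<in> Xsp n" for \<zeta> k m
    unfolding U_def using D(3)[OF orbit_in[OF x]] bound[OF that, of k "k + int m" m]
    by (rule order_trans) simp
  have M_nonneg: "0 \<le> M \<zeta> k" if "\<zeta> \<in> Xsp n" for \<zeta> k
    using D(1) seqnorm_nonneg[OF that] weight_pos[of n k] by (simp add: M_def)
  have null: "w = 0" if "\<And>m. norm w \<le> C * q ^ m" for w :: "real^'n" and C
  proof -
    have "(\<lambda>m. C * q ^ m) \<longlonglongrightarrow> C * 0"
      using q by (intro tendsto_mult tendsto_const LIMSEQ_realpow_zero) auto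
    then have "norm w \<le> C * 0"
      by (rule LIMSEQ_le_const) (use that in auto)
    then show ?thesis by simp
  qed
  \<comment> \<open>Along a full orbit the stable part at \<open>k\<close> equals
    \<open>S \<eta> k m\<close> for every \<open>m\<close>, and the unstable part equals
    \<open>U \<eta> k m\<close>; both are thus at most a null sequence.\<close>
  have kernel: "\<eta> k = 0" if \<eta>: "\<eta> \<in> Xsp n" and zero: "\<And>k. Gamma f (orbit f x) \<eta> k = 0" for \<eta> k
  proof -
    have orb: "\<eta> (j + int m) = Dpow f m (orbit f x j) (\<eta> j)" for j m
    proof (induction m)
      case (Suc m)
      then show ?case
        using zero[of "j + int m + 1"] orbit_add_nat[of x j m] by (simp add: Gamma_def algebra_simps)
    qed simp
    have pr: "proj (orbit f x (j + int m)) (\<eta> (j + int m)) = Dpow f m (orbit f x j) (proj (orbit f x j) (\<eta> j))" for j m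
      unfolding orb orbit_add_nat by (rule proj_Dpow[OF orbit_in[OF x]])
    have "proj (orbit f x k) (\<eta> k) = S \<eta> k m" for m
      unfolding S_def using pr[of "k - int m" m] by simp
    then have "norm (proj (orbit f x k) (\<eta> k)) \<le> M \<eta> k * q ^ m" for m
      using S_le[OF \<eta>, of k m] by simp
    then have s: "proj (orbit f x k) (\<eta> k) = 0"
      by (rule null)
    have "\<eta> k - proj (orbit f x k) (\<eta> k) = U \<eta> k m" for m
    proof -
      have "\<eta> (k + int m) - proj (orbit f x (k + int m)) (\<eta> (k + int m))
          = Dpow f m (orbit f x k) (\<eta> k - proj (orbit f x k) (\<eta> k))"
        unfolding Dpow_diff using pr[of k m] orb[of k m] by simp
      then show ?thesis
        unfolding U_def by (simp only: orbit_add_nat Dpow_inv_Dpow)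
    qed
    then have "norm (\<eta> k - proj (orbit f x k) (\<eta> k)) \<le> M \<eta> k * q ^ m" for m
      using U_le[OF \<eta>, of k m] by simp
    then have "\<eta> k - proj (orbit f x k) (\<eta> k) = 0"
      by (rule null)
    with s show ?thesis by simp
  qed
  have inj: "inj_on (Gamma f (orbit f x)) (Xsp n)"
  proof (rule inj_onI)
    fix \<eta> \<zeta> assume \<eta>: "\<eta> \<in> Xsp n" "\<zeta> \<in> Xsp n" and eq: "Gamma f (orbit f x) \<eta> = Gamma f (orbit f x) \<zeta>"
    then have "Gamma f (orbit f x) (\<lambda>k. \<eta> k - \<zeta> k) k = 0" for k
      by (simp add: Gamma_diff)
    then have "\<eta> k - \<zeta> k = 0" for k
      by (rule kernel[OF Xsp_diff[OF \<eta>]])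
    then show "\<eta> = \<zeta>" by auto
  qed
  have solution: "\<exists>\<eta>\<in>Xsp n. Gamma f (orbit f x) \<eta> = \<zeta> \<and> seqnorm n \<eta> \<le> 2 * D / (1 - q) * seqnorm n \<zeta>"
    if \<zeta>: "\<zeta> \<in> Xsp n" for \<zeta>
  proof -
    note S_sum = geometric_bound_summable[of "S \<zeta> k" for k, OF S_le[OF \<zeta>] q]
    note U_sum = geometric_bound_summable[of "U \<zeta> k" for k, OF U_le[OF \<zeta>] q]
    have "M \<zeta> k * q ^ Suc m \<le> M \<zeta> k * q ^ m" for k m
      using q M_nonneg[OF \<zeta>] by (intro mult_left_mono power_decreasing) auto
    then have U_Suc_le: "norm (U \<zeta> k (Suc m)) \<le> M \<zeta> k * q ^ m" for k m
      using U_le[OF \<zeta>] order_trans by blast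
    note U_Suc_sum = geometric_bound_summable[of "\<lambda>m. U \<zeta> k (Suc m)" for k, OF U_Suc_le q]
    \<comment> \<open>The unstable sum starts at exponent 1, so that the source at \<open>k\<close>
      enters \<open>\<eta> k\<close> only through its stable part.\<close>
    define \<eta> where "\<eta> k = suminf (S \<zeta> k) - (\<Sum>m. U \<zeta> k (Suc m))" for k
    have "Gamma f (orbit f x) \<eta> k = \<zeta> k" for k
    proof -
      define A where "A = Dmap f (orbit f x (k - 1))"
      have A: "bounded_linear A"
        unfolding A_def by (rule Dmap_linear)
      have "A (S \<zeta> (k - 1) m) = S \<zeta> k (Suc m)" for m
      proof -
        have "(f ^^ m) (orbit f x (k - int (Suc m))) = orbit f x (k - 1)"
          using orbit_add_nat[of x "k - int (Suc m)" m] by simp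
        moreover have "k - 1 - int m = k - int (Suc m)" by simp
        ultimately show ?thesis
          unfolding S_def A_def by (simp only: Dpow.simps o_def)
      qed
      then have AS: "A (suminf (S \<zeta> (k - 1))) = (\<Sum>m. S \<zeta> k (Suc m))"
        using bounded_linear.suminf[OF A S_sum(1)] by simp
      have "A (U \<zeta> (k - 1) (Suc m)) = U \<zeta> k m" for m
      proof -
        have "(inv f ^^ m) (orbit f x (k + int m)) = orbit f x k"
          using orbit_diff_nat[of x "k + int m" m] by simp
        moreover have "k - 1 + int (Suc m) = k + int m" by simp
        ultimately show ?thesis
          unfolding U_def A_def inv_orbit[symmetric] by (simp only: Dpow.simps o_def Dmap_Dmap_inv')
      qed
      then have AU: "A (\<Sum>m. U \<zeta> (k - 1) (Suc m)) = suminf (U \<zeta> k)"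
        using bounded_linear.suminf[OF A U_Suc_sum(1)] by simp
      have "A (\<eta> (k - 1)) = (\<Sum>m. S \<zeta> k (Suc m)) - suminf (U \<zeta> k)"
        unfolding \<eta>_def linear_diff[OF bounded_linear.linear[OF A]] AS AU ..
      \<comment> \<open>The derivative shifts both series by one term, so all cancels except the
        stable and unstable parts of \<open>\<zeta> k\<close>.\<close>
      then have "Gamma f (orbit f x) \<eta> k = S \<zeta> k 0 + U \<zeta> k 0"
        unfolding Gamma_def A_def[symmetric]
        using suminf_split_head[OF S_sum(1)[of k]] suminf_split_head[OF U_sum(1)[of k]]
        by (simp add: \<eta>_def[of k] algebra_simps)
      then show ?thesis by (simp add: S_def U_def)
    qed
    moreover have le: "weight n k * norm (\<eta> k) \<le> 2 * D / (1 - q) * seqnorm n \<zeta>" for k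
    proof -
      have "norm (\<eta> k) \<le> M \<zeta> k / (1 - q) + M \<zeta> k / (1 - q)"
        unfolding \<eta>_def by (rule order_trans[OF norm_triangle_ineq4 add_mono[OF S_sum(2) U_Suc_sum(2)]])
      then have "weight n k * norm (\<eta> k) \<le> weight n k * (2 * M \<zeta> k / (1 - q))"
        using weight_pos[of n k] by (intro mult_left_mono) auto
      also have "\<dots> = 2 * D / (1 - q) * seqnorm n \<zeta>"
        using weight_pos[of n k] by (simp add: M_def)
      finally show ?thesis .
    qed
    ultimately show ?thesis
      using XspI[of n \<eta>, OF le] seqnorm_leI[of n \<eta>, OF le] by (intro bexI[of _ \<eta>]) auto
  qed
  show "bij_betw (Gamma f (orbit f x)) (Xsp n) (Xsp n)"
    unfolding bij_betw_def
  proof (intro conjI inj equalityI)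
    show "Gamma f (orbit f x) ` Xsp n \<subseteq> Xsp n"
      using Gamma_in_Xsp by blast
    show "Xsp n \<subseteq> Gamma f (orbit f x) ` Xsp n"
      using solution by blast
  qed
  show "seqnorm n \<eta> \<le> 2 * D / (1 - lam * weight_rate n) * seqnorm n (Gamma f (orbit f x) \<eta>)"
    if \<eta>: "\<eta> \<in> Xsp n"
  proof -
    obtain \<eta>' where \<eta>': "\<eta>' \<in> Xsp n" "Gamma f (orbit f x) \<eta>' = Gamma f (orbit f x) \<eta>"
        "seqnorm n \<eta>' \<le> 2 * D / (1 - q) * seqnorm n (Gamma f (orbit f x) \<eta>)"
      using solution[OF Gamma_in_Xsp[OF \<eta>]] by blast
    have "\<eta>' = \<eta>"
      by (rule inj_onD[OF inj \<eta>'(2,1) \<eta>])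
    with \<eta>'(3) show ?thesis
      by (simp add: q_def)
  qed
qed

text \<open>The constant in \<open>Gamma_invertible\<close> does not depend on the point
  \<open>x\<close>.\<close>

lemma Gamma_condI:
  assumes "lam * weight_rate n < 1"
  shows "Gamma_cond f \<Lambda> n"
proof -
  obtain D where D: "D > 0"
    "\<And>x m v. x \<in> \<Lambda> \<Longrightarrow> norm (Dpow f m x (proj x v)) \<le> D * lam ^ m * norm v"
    "\<And>x m v. x \<in> \<Lambda> \<Longrightarrow> norm (Dpow (inv f) m x (v - proj x v)) \<le> D * lam ^ m * norm v"
    by (rule dichotomy) (rule that)
  have "0 \<le> 2 * D / (1 - lam * weight_rate n)"
    using D(1) assms by simp
  from has_cont_inverseI[OF Gamma_invertible(1)[OF D assms] this Gamma_invertible(2)[OF D assms]]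
  show ?thesis
    by (auto simp: Gamma_cond_def intro!: bdd_aboveI2)
qed

end

theorem theorem1:
  fixes f :: "'n::finite torus \<Rightarrow> 'n torus" and \<Lambda> :: "'n torus set"
  assumes "C1_diffeo_torus f"
    and "torus_closed \<Lambda>"
    and "f ` \<Lambda> = \<Lambda>"
  shows "(unif_hyperbolic f \<Lambda> \<longleftrightarrow> (\<exists>n0. n0 \<noteq> 0 \<and> Gamma_cond f \<Lambda> n0))
    \<and> ((\<exists>n0. n0 \<noteq> 0 \<and> Gamma_cond f \<Lambda> n0) \<longrightarrow>
         (\<exists>N>0. \<forall>n\<ge>N. Gamma_cond f \<Lambda> (enat n)) \<and> Gamma_cond f \<Lambda> \<infinity>)"
proof -
  interpret invariant_set f \<Lambda>
    using assms by unfold_locales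
  \<comment> \<open>Everything passes through hyperbolicity: it yields the condition for all large
    \<open>n\<close> and for \<open>\<infinity>\<close>, and the condition for a single index gives
    it back.\<close>
  have "(\<exists>N>0. \<forall>n\<ge>N. Gamma_cond f \<Lambda> (enat n)) \<and> Gamma_cond f \<Lambda> \<infinity>" if hyp: "unif_hyperbolic f \<Lambda>"
  proof -
    obtain c lam Es Eu where "hyperbolic_set f \<Lambda> c lam Es Eu"
    proof -
      from hyp obtain c lam :: real and Es Eu where
        c: "c > 0" "0 < lam" "lam < 1" and
        H: "\<forall>x\<in>\<Lambda>. subspace (Es x) \<and> subspace (Eu x) \<and> Es x \<inter> Eu x = {0} \<and>
          (\<forall>v. \<exists>a\<in>Es x. \<exists>b\<in>Eu x. v = a + b) \<and>
          Dmap f x ` Es x = Es (f x) \<and> Dmap f x ` Eu x = Eu (f x) \<and>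
          (\<forall>k>0. \<forall>\<eta>\<in>Es x. norm (Dpow f k x \<eta>) \<le> c * lam ^ k * norm \<eta>) \<and>
          (\<forall>k>0. \<forall>\<eta>\<in>Eu x. norm (Dpow (inv f) k x \<eta>) \<le> c * lam ^ k * norm \<eta>)"
        unfolding unif_hyperbolic_def by (elim exE conjE) (rule that)
      have "hyperbolic_set f \<Lambda> c lam Es Eu"
        by unfold_locales (simp_all add: c H)
      then show ?thesis by (rule that)
    qed
    then interpret hyperbolic_set f \<Lambda> c lam Es Eu .
    have "(\<lambda>n. lam * exp (1 / real n)) \<longlonglongrightarrow> lam * exp 0"
      by (intro tendsto_intros lim_1_over_n)
    then have "\<forall>\<^sub>F n in sequentially. lam * exp (1 / real n) < 1"
      by (rule order_tendstoD) (use lam in simp)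
    then obtain N where "lam * weight_rate (enat n) < 1" if "n \<ge> N" for n
      by (auto simp: eventually_sequentially weight_rate_def)
    \<comment> \<open>The successor makes the threshold positive.\<close>
    then have "\<forall>n\<ge>Suc N. Gamma_cond f \<Lambda> (enat n)"
      using Gamma_condI by simp
    moreover have "Gamma_cond f \<Lambda> \<infinity>"
      by (rule Gamma_condI) (use lam in \<open>simp add: weight_rate_def\<close>)
    ultimately show ?thesis by blast
  qed
  moreover have "unif_hyperbolic f \<Lambda>" if "Gamma_cond f \<Lambda> n" for n
    by (rule Gamma_cond_imp_unif_hyperbolic[OF that])
  \<comment> \<open>\<open>\<infinity>\<close> serves as the witness \<open>n0\<close> in the
    forward implication.\<close>
  moreover have "(\<infinity> :: enat) \<noteq> 0" by simp
  ultimately show ?thesis by blast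
qed

end
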